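(* Let $n\geq 3$ be a fixed integer. There exists no number $c>0$ such that for all convex bodies $K\subseteq\mathbb{R}^n$ $$\#(K)^{\frac{n-1}{n}} \geq c \Big(\prod_{i=1}^n \#(K\cap\mathbf{e}_i^\perp)\Big)^{\frac1n}.$$
   Context: A convex body in $\mathbb{R}^n$ is a compact convex set (not necessarily symmetric). For $M\subseteq\mathbb{R}^n$, $\#(M)=|M\cap\mathbb{Z}^n|$ is the number of integer points in $M$. $\mathbf{e}_i$ is the $i$-th standard unit vector and $\mathbf{e}_i^\perp=\{\mathbf{x}\in\mathbb{R}^n: x_i=0\}$. *)

theory Defs
  imports "HOL-Analysis.Analysis"
begin

text \<open>Neither symmetry nor nonempty interior is required.\<close>

definition convex_body :: "(real ^ 'n) set \<Rightarrow> bool" where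
  "convex_body K \<longleftrightarrow> compact K \<and> convex K"

definition int_lattice :: "(real ^ 'n) set" where
  "int_lattice = {x. \<forall>i. x $ i \<in> \<int>}"

text \<open>Since \<^const>\<open>card\<close> is 0 on infinite sets, this is the intended number only when
  \<open>M \<inter> int_lattice\<close> is finite, in particular for bounded \<open>M\<close>.\<close>

definition lattice_count :: "(real ^ 'n) set \<Rightarrow> nat" where
  "lattice_count M = card (M \<inter> int_lattice)"

definition coord_hyperplane :: "'n \<Rightarrow> (real ^ 'n) set" where
  "coord_hyperplane i = {x. x $ i = 0}"

end

theory Submission
  imports Defs
begin

text \<open>
  Fix three distinct coordinates a, b, c and let K be the convex hull of the segment from 0 to
  N e_c, in the hyperplane x_a = 0, and the segment from e_a to e_a + N e_b, in the hyperplane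
  x_a = 1. No integer point of K lies strictly between these two hyperplanes, so K has only
  2(N + 1) of them. But every coordinate hyperplane contains an integral translate of one of the
  two segments, hence at least N + 1 integer points of K, and (2(N + 1))^((n - 1)/n) is of smaller
  order than N + 1.
\<close>

text \<open>For distinct a, b, c the slice at x_a = t, with 0 \<le> t \<le> 1, is the rectangle 0
  \<le> x_b \<le> N t, 0 \<le> x_c \<le> N (1 - t), which is (1 - t) times the first segment plus t
  times the second. Hence these inequalities cut out exactly the convex hull, while compactness and
  convexity can be read off from a box and two half-spaces.\<close>

definition skew_tetrahedron :: "'n \<Rightarrow> 'n \<Rightarrow> 'n \<Rightarrow> nat \<Rightarrow> (real ^ 'n) set" where
  "skew_tetrahedron a b c N =
    cbox 0 (\<chi> i. if i = a then 1 else if i = b \<or> i = c then real N else 0)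
    \<inter> {x. x $ b \<le> real N * x $ a} \<inter> {x. x $ c + real N * x $ a \<le> real N}"

lemma convex_body_skew_tetrahedron:
  "convex_body (skew_tetrahedron a b c N :: (real ^ 'n::finite) set)"
proof -
  have 1: "{x :: real ^ 'n. x $ b \<le> real N * x $ a} =
      {x. inner (axis b 1 - real N *\<^sub>R axis a 1) x \<le> 0}"
    by (simp add: inner_diff_left inner_axis')
  have 2: "{x :: real ^ 'n. x $ c + real N * x $ a \<le> real N} =
      {x. inner (axis c 1 + real N *\<^sub>R axis a 1) x \<le> real N}"
    by (simp add: inner_add_left inner_axis')
  show ?thesis
    unfolding convex_body_def skew_tetrahedron_def 1 2
    by (intro conjI compact_Int_closed convex_Int compact_cbox convex_box convex_halfspace_le
        closed_halfspace_le)
qed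

text \<open>An integer x_a in [0, 1] is 0 or 1. At 0 the first half-space forces x_b = 0 and only
  x_c is free; at 1 the second forces x_c = 0 and only x_b is free.\<close>

lemma skew_tetrahedron_int_lattice:
  fixes a b c :: "'n::finite"
  assumes "a \<noteq> b" "a \<noteq> c" "b \<noteq> c"
  shows "skew_tetrahedron a b c N \<inter> int_lattice =
    (\<lambda>j. axis c (real j)) ` {..N} \<union> (\<lambda>j. axis a 1 + axis b (real j)) ` {..N}"
    (is "?L = ?R")
proof
  show "?R \<subseteq> ?L"
    using assms by (auto simp: skew_tetrahedron_def int_lattice_def mem_box_cart axis_def)
  show "?L \<subseteq> ?R"
  proof
    fix x assume x: "x \<in> ?L"
    then have int: "x $ i \<in> \<int>" for i
      by (auto simp: int_lattice_def)
    from x have bounds: "0 \<le> x $ i"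
      "x $ i \<le> (if i = a then 1 else if i = b \<or> i = c then real N else 0)" for i
      by (auto simp: skew_tetrahedron_def mem_box_cart)
    have zero: "x $ i = 0" if "i \<noteq> a" "i \<noteq> b" "i \<noteq> c" for i
      using bounds[of i] that by simp
    have xb: "x $ b \<le> real N * x $ a" and xc: "x $ c + real N * x $ a \<le> real N"
      using x by (auto simp: skew_tetrahedron_def)
    have coord: "\<exists>j\<le>N. x $ i = real j" if "i = b \<or> i = c" for i
    proof -
      obtain k :: int where k: "x $ i = of_int k"
        using int[of i] by (auto elim: Ints_cases)
      have "0 \<le> k" "k \<le> int N"
        using bounds[of i] assms that k by auto
      then show ?thesis
        using k by (intro exI[of _ "nat k"]) auto
    qed
    obtain k :: int where k: "x $ a = of_int k"
      using int[of a] by (auto elim: Ints_cases)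
    with bounds[of a] have "k = 0 \<or> k = 1"
      by auto
    then show "x \<in> ?R"
    proof
      assume "k = 0"
      then have a: "x $ a = 0" and b: "x $ b = 0"
        using k xb bounds(1)[of b] by auto
      obtain j where j: "j \<le> N" "x $ c = real j"
        using coord[of c] by auto
      have "x = axis c (real j)"
        using a b j by (auto simp: vec_eq_iff axis_def) (metis zero)
      with j show ?thesis by auto
    next
      assume "k = 1"
      then have a: "x $ a = 1" and c: "x $ c = 0"
        using k xc bounds(1)[of c] by auto
      obtain j where j: "j \<le> N" "x $ b = real j"
        using coord[of b] by auto
      have "x = axis a 1 + axis b (real j)"
        using a c j assms by (auto simp: vec_eq_iff axis_def) (metis zero)
      with j show ?thesis by auto
    qed
  qed
qed

lemma lattice_count_skew_tetrahedron_le: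
  fixes a b c :: "'n::finite"
  assumes "a \<noteq> b" "a \<noteq> c" "b \<noteq> c"
  shows "lattice_count (skew_tetrahedron a b c N) \<le> 2 * (N + 1)"
proof -
  have "card ((\<lambda>j. axis c (real j) :: real ^ 'n) ` {..N}) \<le> N + 1"
    "card ((\<lambda>j. axis a 1 + axis b (real j) :: real ^ 'n) ` {..N}) \<le> N + 1"
    using card_image_le[of "{..N}"] by fastforce+
  then show ?thesis
    unfolding lattice_count_def skew_tetrahedron_int_lattice[OF assms]
    by (intro order_trans[OF card_Un_le]) simp
qed

lemma lattice_count_skew_tetrahedron_section_ge:
  fixes a b c i :: "'n::finite"
  assumes "a \<noteq> b" "a \<noteq> c" "b \<noteq> c"
  shows "N + 1 \<le> lattice_count (skew_tetrahedron a b c N \<inter> coord_hyperplane i)"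
proof -
  \<comment> \<open>Points of the segment along e_c vanish in every coordinate other than c, so this
    segment serves all i \<noteq> c. For i = c the other segment is used, whose points have c-th
    coordinate 0.\<close>
  define f :: "nat \<Rightarrow> real ^ 'n" where
    "f = (if i = c then (\<lambda>j. axis a 1 + axis b (real j)) else (\<lambda>j. axis c (real j)))"
  have "inj f"
    by (auto simp: f_def inj_on_def axis_eq_axis)
  then have "N + 1 = card (f ` {..N})"
    by (simp add: card_image inj_on_subset)
  also have "\<dots> \<le> card (skew_tetrahedron a b c N \<inter> int_lattice \<inter> coord_hyperplane i)"
  proof (rule card_mono)
    show "finite (skew_tetrahedron a b c N \<inter> int_lattice \<inter> coord_hyperplane i)"
      unfolding skew_tetrahedron_int_lattice[OF assms] by simp
    show "f ` {..N} \<subseteq> skew_tetrahedron a b c N \<inter> int_lattice \<inter> coord_hyperplane i"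
      unfolding skew_tetrahedron_int_lattice[OF assms] using assms
      by (auto simp: f_def coord_hyperplane_def axis_def)
  qed
  finally show ?thesis
    by (simp add: lattice_count_def Int_ac)
qed

theorem proposition3p1:
  assumes "CARD('n::finite) \<ge> 3"
  shows "\<not> (\<exists>c::real. c > 0 \<and>
    (\<forall>K :: (real ^ 'n) set. convex_body K \<longrightarrow>
      real (lattice_count K) powr ((real CARD('n) - 1) / real CARD('n))
        \<ge> c * (\<Prod>i\<in>UNIV. real (lattice_count (K \<inter> coord_hyperplane i)))
               powr (1 / real CARD('n))))"
proof
  assume "\<exists>c::real. c > 0 \<and>
    (\<forall>K :: (real ^ 'n) set. convex_body K \<longrightarrow>
      real (lattice_count K) powr ((real CARD('n) - 1) / real CARD('n))
        \<ge> c * (\<Prod>i\<in>UNIV. real (lattice_count (K \<inter> coord_hyperplane i)))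
               powr (1 / real CARD('n)))"
  then obtain C :: real where C: "C > 0"
    and bound: "\<And>K :: (real ^ 'n) set. convex_body K \<Longrightarrow>
      C * (\<Prod>i\<in>UNIV. real (lattice_count (K \<inter> coord_hyperplane i))) powr (1 / real CARD('n))
      \<le> real (lattice_count K) powr ((real CARD('n) - 1) / real CARD('n))"
    by blast
  obtain T :: "'n set" where "card T = 3"
    using obtain_subset_with_card_n[OF assms] by metis
  then obtain a b c :: 'n where abc: "a \<noteq> b" "a \<noteq> c" "b \<noteq> c"
    by (auto simp: card_3_iff)
  define n where "n = real CARD('n)"
  have n: "n \<ge> 3"
    using assms by (simp add: n_def)
  \<comment> \<open>The assumed bound will give N + 1 \<le> (2 / C)^n, so this choice of N
    contradicts it.\<close>
  obtain N :: nat where N: "(2 / C) powr n < real N"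
    using reals_Archimedean2 by blast
  define M where "M = real (N + 1)"
  define K where "K = skew_tetrahedron a b c N"
  have M: "M \<ge> 1"
    by (simp add: M_def)
  \<comment> \<open>\<open>M\<close> is written as the geometric mean of n copies of itself, to be
    compared factor by factor with the product over the n sections.\<close>
  have "M = (M ^ CARD('n)) powr (1 / n)"
    using M n by (simp add: n_def powr_powr flip: powr_realpow)
  also have "\<dots> \<le> (\<Prod>i\<in>UNIV. real (lattice_count (K \<inter> coord_hyperplane i))) powr (1 / n)"
  proof (rule powr_mono2)
    have "(\<Prod>i\<in>(UNIV :: 'n set). M) \<le> (\<Prod>i\<in>UNIV. real (lattice_count (K \<inter> coord_hyperplane i)))"
    proof (rule prod_mono)
      show "0 \<le> M \<and> M \<le> real (lattice_count (K \<inter> coord_hyperplane i))" for i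
        using M lattice_count_skew_tetrahedron_section_ge[OF abc, of N i]
        unfolding M_def K_def by (simp only: of_nat_le_iff) simp
    qed
    then show "M ^ CARD('n) \<le> (\<Prod>i\<in>UNIV. real (lattice_count (K \<inter> coord_hyperplane i)))"
      by simp
  qed (use M n in auto)
  finally have "C * M \<le> C * \<dots>"
    using C by simp
  also have "\<dots> \<le> real (lattice_count K) powr ((n - 1) / n)"
    using bound[of K] by (simp add: K_def n_def convex_body_skew_tetrahedron)
  also have "\<dots> \<le> (2 * M) powr ((n - 1) / n)"
  proof (rule powr_mono2)
    show "real (lattice_count K) \<le> 2 * M"
      using lattice_count_skew_tetrahedron_le[OF abc, of N] unfolding M_def K_def by linarith
  qed (use n in auto)
  also have "\<dots> = 2 powr ((n - 1) / n) * M powr ((n - 1) / n)"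
    using M by (simp add: powr_mult)
  \<comment> \<open>The exponent is below 1, so the constant is at most 2; only the power of
    \<open>M\<close> matters for the growth.\<close>
  also have "\<dots> \<le> 2 * M powr ((n - 1) / n)"
    using powr_mono[of "(n - 1) / n" 1 "2 :: real"] n by (intro mult_right_mono) auto
  \<comment> \<open>The chain now reads C M \<le> 2 M / M^(1/n). Cancelling \<open>M\<close> leaves
    a bound on M^(1/n) that does not depend on \<open>N\<close>.\<close>
  also have "M powr ((n - 1) / n) = M / M powr (1 / n)"
    using M n by (simp add: diff_divide_distrib powr_diff)
  finally have "M powr (1 / n) \<le> 2 / C"
    using M C by (simp add: field_simps)
  then have "(M powr (1 / n)) powr n \<le> (2 / C) powr n"
    using n by (intro powr_mono2) auto
  then have "M \<le> (2 / C) powr n"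
    using M n by (simp add: powr_powr)
  with N show False
    by (simp add: M_def)
qed

end
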